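(* Let $G$ be a finitely presentable group with $\mathrm{adim}\, G=1$, and let $\Gamma$ be the Cayley graph of $G$ with respect to a finite generating set. Then there exists $M>0$ such that every $1$-sequence in $V\Gamma$ is $M$-triangulable.
   Context: The Cayley graph $\Gamma$ of $G$ with respect to a finite generating set $X$ has vertex set $V\Gamma=G$, edge set $G\times X$, and the edge $(g,x)$ joins $g$ to $gx$; $d$ is the path metric on $V\Gamma$. Asymptotic dimension: a metric space $(X,d)$ has asymptotic dimension at most $n$ if for every $m>0$ there is a partition $\mathcal P$ of $X$ into sets of uniformly bounded diameter such that the $m$-graph of $\mathcal P$ is $(n+1)$-colorable, where the $m$-graph has vertex set $\mathcal P$ and two (distinct) elements of $\mathcal P$ are joined by an edge if they are at distance at most $m$. The asymptotic dimension equals $n$ if it is at most $n$ and not at most $n-1$. For a finitely generated group $G$, $\mathrm{adim}\,G$ is the asymptotic dimension of its Cayley graph with respect to a finite generating set (it does not depend on the generating set). Triangulability: for an integer $m\ge 0$, an $m$-sequence of length $n$ in $V\Gamma$ is a finite sequence $(v_0,\dots,v_n)$ with $v_n=v_0$ and $d(v_i,v_{i+1})\le m$ for $0\le i\le n-1$. If $1\le i\le n-1$ and $d(v_{i-1},v_{i+1})\le m$, then deleting $v_i$ (giving the $m$-sequence $(v_0,\dots,v_{i-1},v_{i+1},\dots,v_n)$) is an $m$-reduction. An $m$-sequence is $m$-triangulable if it has length $\le 3$ or some $m$-reduction of it is $m$-triangulable (recursively). *)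

theory Defs
  imports Complex_Main "HOL-Algebra.Generated_Groups" "HOL-Library.Disjoint_Sets"
begin

section \<open>Finite presentability\<close>

text \<open>A letter \<open>(x, True)\<close> stands for the generator \<open>x\<close>, and \<open>(x, False)\<close> for its formal inverse.\<close>

type_synonym 'x word = "('x \<times> bool) list"

definition words :: "'x set \<Rightarrow> 'x word set" where
  "words S = lists (S \<times> UNIV)"

inductive_set free_eq :: "'x set \<Rightarrow> ('x word \<times> 'x word) set" for S where
  refl: "u \<in> words S \<Longrightarrow> (u, u) \<in> free_eq S"
| cancel: "\<lbrakk>u \<in> words S; v \<in> words S; x \<in> S\<rbrakk>
    \<Longrightarrow> (u @ [(x, b), (x, \<not> b)] @ v, u @ v) \<in> free_eq S"
| sym: "(u, v) \<in> free_eq S \<Longrightarrow> (v, u) \<in> free_eq S"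
| trans: "\<lbrakk>(u, v) \<in> free_eq S; (v, w) \<in> free_eq S\<rbrakk> \<Longrightarrow> (u, w) \<in> free_eq S"

definition free_group :: "'x set \<Rightarrow> 'x word set monoid" where
  "free_group S =
    \<lparr>carrier = words S // free_eq S,
     monoid.mult = (\<lambda>A B. free_eq S `` {u @ v | u v. u \<in> A \<and> v \<in> B}),
     monoid.one = free_eq S `` {[]}\<rparr>"

definition normal_closure :: "('a, 'b) monoid_scheme \<Rightarrow> 'a set \<Rightarrow> 'a set" where
  "normal_closure G R = \<Inter>{N. N \<lhd> G \<and> R \<subseteq> N}"

definition finitely_presentable :: "('a, 'b) monoid_scheme \<Rightarrow> bool" where
  "finitely_presentable G \<longleftrightarrow>
    (\<exists>(n::nat) R. finite R \<and> R \<subseteq> carrier (free_group {..<n}) \<and>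
       G \<cong> free_group {..<n} Mod normal_closure (free_group {..<n}) R)"

lemma equiv_free_eq: "equiv (words S) (free_eq S)"
proof -
  have "u \<in> words S \<and> v \<in> words S" if "(u, v) \<in> free_eq S" for u v
    using that by induction (auto simp: words_def)
  then have "free_eq S \<subseteq> words S \<times> words S"
    by auto
  moreover have "refl_on (words S) (free_eq S)"
    by (auto simp: refl_on_def intro: free_eq.refl)
  moreover have "Relation.sym (free_eq S)" "Relation.trans (free_eq S)"
    by (auto intro!: symI transI intro: free_eq.sym free_eq.trans)
  ultimately show ?thesis
    by (simp add: equiv_def)
qed

lemma free_eq_words: "(u, v) \<in> free_eq S \<Longrightarrow> u \<in> words S \<and> v \<in> words S"
  using equiv_free_eq[of S] unfolding equiv_def by auto

lemma words_append: "u @ v \<in> words S \<longleftrightarrow> u \<in> words S \<and> v \<in> words S"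
  by (auto simp: words_def)

lemma free_eq_append_left:
  assumes "(u, v) \<in> free_eq S" "w \<in> words S"
  shows "(w @ u, w @ v) \<in> free_eq S"
  using assms
proof induction
  case (cancel u v x b)
  then show ?case
    using free_eq.cancel[of "w @ u" S v x b] by (simp add: words_append)
qed (auto intro: free_eq.intros simp: words_append)

lemma free_eq_append_right:
  assumes "(u, v) \<in> free_eq S" "w \<in> words S"
  shows "(u @ w, v @ w) \<in> free_eq S"
  using assms
proof induction
  case (cancel u v x b)
  then show ?case
    using free_eq.cancel[of u S "v @ w" x b] by (simp add: words_append)
qed (auto intro: free_eq.intros simp: words_append)

lemma free_eq_append:
  "(u, u') \<in> free_eq S \<Longrightarrow> (v, v') \<in> free_eq S \<Longrightarrow> (u @ v, u' @ v') \<in> free_eq S"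
  by (meson free_eq.trans free_eq_append_left free_eq_append_right free_eq_words)

lemma free_group_mult:
  assumes "u \<in> words S" "v \<in> words S"
  shows "free_eq S `` {u} \<otimes>\<^bsub>free_group S\<^esub> free_eq S `` {v} = free_eq S `` {u @ v}"
proof -
  have "(u @ v, w) \<in> free_eq S"
    if "(u, u') \<in> free_eq S" "(v, v') \<in> free_eq S" "(u' @ v', w) \<in> free_eq S" for u' v' w
    using that by (meson free_eq.trans free_eq_append)
  then show ?thesis
    using assms by (auto simp: free_group_def Image_def intro: free_eq.refl)
qed

lemma free_eq_inverse:
  assumes "u \<in> words S"
  shows "(rev (map (\<lambda>(x, b). (x, \<not> b)) u) @ u, []) \<in> free_eq S"
  using assms
proof (induction u)
  case Nil
  then show ?case
    by (simp add: free_eq.refl)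
next
  case (Cons a u)
  obtain x b where a: "a = (x, b)" by fastforce
  let ?r = "rev (map (\<lambda>(x, b). (x, \<not> b)) u)"
  have u: "u \<in> words S" "x \<in> S" "?r \<in> words S"
    using Cons.prems by (auto simp: words_def a)
  have "(?r @ [(x, \<not> b), (x, \<not> \<not> b)] @ u, ?r @ u) \<in> free_eq S"
    using u by (intro free_eq.cancel)
  with Cons.IH[OF u(1)] show ?case
    by (auto simp: a intro: free_eq.trans)
qed

lemma group_free_group: "group (free_group S)"
proof (rule groupI)
  have carr: "A \<in> carrier (free_group S) \<longleftrightarrow> (\<exists>u \<in> words S. A = free_eq S `` {u})" for A
    by (auto simp: free_group_def quotient_def)
  have nil: "[] \<in> words S" and one: "\<one>\<^bsub>free_group S\<^esub> = free_eq S `` {[]}"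
    by (auto simp: words_def free_group_def)
  show "\<one>\<^bsub>free_group S\<^esub> \<in> carrier (free_group S)"
    using nil by (auto simp: one carr)
  fix A assume "A \<in> carrier (free_group S)"
  then obtain u where u: "u \<in> words S" "A = free_eq S `` {u}"
    by (auto simp: carr)
  show "\<one>\<^bsub>free_group S\<^esub> \<otimes>\<^bsub>free_group S\<^esub> A = A"
    using u nil by (simp add: one free_group_mult)
  show "\<exists>B \<in> carrier (free_group S). B \<otimes>\<^bsub>free_group S\<^esub> A = \<one>\<^bsub>free_group S\<^esub>"
  proof
    let ?r = "rev (map (\<lambda>(x, b). (x, \<not> b)) u)"
    have r: "?r \<in> words S"
      using u by (auto simp: words_def)
    then show "free_eq S `` {?r} \<in> carrier (free_group S)"
      by (auto simp: carr)
    show "free_eq S `` {?r} \<otimes>\<^bsub>free_group S\<^esub> A = \<one>\<^bsub>free_group S\<^esub>"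
      using u r by (simp add: one free_group_mult equiv_class_eq[OF equiv_free_eq free_eq_inverse])
  qed
  fix B assume "B \<in> carrier (free_group S)"
  then obtain v where v: "v \<in> words S" "B = free_eq S `` {v}"
    by (auto simp: carr)
  show "A \<otimes>\<^bsub>free_group S\<^esub> B \<in> carrier (free_group S)"
    using u v by (auto simp: free_group_mult carr words_append)
  fix C assume "C \<in> carrier (free_group S)"
  then obtain w where w: "w \<in> words S" "C = free_eq S `` {w}"
    by (auto simp: carr)
  show "A \<otimes>\<^bsub>free_group S\<^esub> B \<otimes>\<^bsub>free_group S\<^esub> C = A \<otimes>\<^bsub>free_group S\<^esub> (B \<otimes>\<^bsub>free_group S\<^esub> C)"
    using u v w by (simp add: free_group_mult words_append)
qed


section \<open>Cayley graphs\<close>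

definition finite_generating_set :: "('a, 'b) monoid_scheme \<Rightarrow> 'a set \<Rightarrow> bool" where
  "finite_generating_set G S \<longleftrightarrow> finite S \<and> S \<subseteq> carrier G \<and> generate G S = carrier G"

text \<open>The adjacency relation of the Cayley graph; edges can be traversed in both directions.\<close>

definition cayley_adj :: "('a, 'b) monoid_scheme \<Rightarrow> 'a set \<Rightarrow> ('a \<times> 'a) set" where
  "cayley_adj G S =
    {(g, h). g \<in> carrier G \<and> h \<in> carrier G \<and> (\<exists>x\<in>S. h = g \<otimes>\<^bsub>G\<^esub> x \<or> g = h \<otimes>\<^bsub>G\<^esub> x)}"

definition cayley_dist :: "('a, 'b) monoid_scheme \<Rightarrow> 'a set \<Rightarrow> 'a \<Rightarrow> 'a \<Rightarrow> nat" where
  "cayley_dist G S g h = (LEAST n. (g, h) \<in> cayley_adj G S ^^ n)"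


section \<open>Asymptotic dimension\<close>

definition set_distance :: "('a \<Rightarrow> 'a \<Rightarrow> real) \<Rightarrow> 'a set \<Rightarrow> 'a set \<Rightarrow> real" where
  "set_distance d A B = Inf {d x y | x y. x \<in> A \<and> y \<in> B}"

definition m_graph_adj :: "('a \<Rightarrow> 'a \<Rightarrow> real) \<Rightarrow> real \<Rightarrow> 'a set \<Rightarrow> 'a set \<Rightarrow> bool" where
  "m_graph_adj d m A B \<longleftrightarrow> A \<noteq> B \<and> set_distance d A B \<le> m"

definition m_graph_colorable :: "('a \<Rightarrow> 'a \<Rightarrow> real) \<Rightarrow> real \<Rightarrow> 'a set set \<Rightarrow> nat \<Rightarrow> bool" where
  "m_graph_colorable d m P k \<longleftrightarrow>
    (\<exists>c :: 'a set \<Rightarrow> nat. c ` P \<subseteq> {..<k} \<and>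
       (\<forall>A\<in>P. \<forall>B\<in>P. m_graph_adj d m A B \<longrightarrow> c A \<noteq> c B))"

definition asdim_le :: "'a set \<Rightarrow> ('a \<Rightarrow> 'a \<Rightarrow> real) \<Rightarrow> nat \<Rightarrow> bool" where
  "asdim_le M d n \<longleftrightarrow>
    (\<forall>m>0. \<exists>P. partition_on M P \<and>
       (\<exists>D. \<forall>A\<in>P. \<forall>x\<in>A. \<forall>y\<in>A. d x y \<le> D) \<and>
       m_graph_colorable d m P (n + 1))"

definition asdim_eq :: "'a set \<Rightarrow> ('a \<Rightarrow> 'a \<Rightarrow> real) \<Rightarrow> nat \<Rightarrow> bool" where
  "asdim_eq M d n \<longleftrightarrow> asdim_le M d n \<and> (n > 0 \<longrightarrow> \<not> asdim_le M d (n - 1))"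

text \<open>The asymptotic dimension does not depend on the finite generating set, so it does not matter
  that the set below is quantified existentially.\<close>

definition group_adim_eq :: "('a, 'b) monoid_scheme \<Rightarrow> nat \<Rightarrow> bool" where
  "group_adim_eq G n \<longleftrightarrow>
    (\<exists>S. finite_generating_set G S \<and>
       asdim_eq (carrier G) (\<lambda>g h. real (cayley_dist G S g h)) n)"


section \<open>Triangulability\<close>

text \<open>The sequence \<open>(v\<^sub>0, \<dots>, v\<^sub>n)\<close> of length \<open>n\<close> is a list with \<open>n + 1\<close> entries.\<close>

definition m_sequence :: "('a, 'b) monoid_scheme \<Rightarrow> 'a set \<Rightarrow> nat \<Rightarrow> 'a list \<Rightarrow> bool" where
  "m_sequence G S m vs \<longleftrightarrow>
    vs \<noteq> [] \<and> set vs \<subseteq> carrier G \<and> last vs = hd vs \<and>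
    (\<forall>i. i + 1 < length vs \<longrightarrow> cayley_dist G S (vs ! i) (vs ! (i + 1)) \<le> m)"

definition m_reduction :: "('a, 'b) monoid_scheme \<Rightarrow> 'a set \<Rightarrow> nat \<Rightarrow> 'a list \<Rightarrow> 'a list \<Rightarrow> bool" where
  "m_reduction G S m vs ws \<longleftrightarrow>
    (\<exists>i. 1 \<le> i \<and> i + 1 < length vs \<and>
       cayley_dist G S (vs ! (i - 1)) (vs ! (i + 1)) \<le> m \<and>
       ws = take i vs @ drop (i + 1) vs)"

inductive m_triangulable :: "('a, 'b) monoid_scheme \<Rightarrow> 'a set \<Rightarrow> nat \<Rightarrow> 'a list \<Rightarrow> bool"
  for G S m where
  short: "\<lbrakk>m_sequence G S m vs; length vs \<le> 3 + 1\<rbrakk> \<Longrightarrow> m_triangulable G S m vs"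
| reduce: "\<lbrakk>m_sequence G S m vs; m_reduction G S m vs ws; m_triangulable G S m ws\<rbrakk>
    \<Longrightarrow> m_triangulable G S m vs"

end

theory Submission
  imports Defs
begin

text \<open>Fix a finite presentation and take a partition into bounded pieces whose nerve is 2-coloured
  at a scale exceeding the diameter of all relators. A translate of a relator then meets at most two
  pieces, so its image in the nerve, which is a graph, is null-homotopic. Hence the map sending a
  group element to its piece lifts to the universal cover of the nerve, a tree whose vertices are
  the reduced walks from the piece of a base point. Two elements with equal or adjacent images in
  the tree are at bounded distance. Given a closed sequence based at the root, with consecutive
  images equal or adjacent, pick an interior vertex of maximal height: its two neighbours lie over
  the same tree vertex or its parent, so it may be deleted.\<close>

section \<open>Reduced walks\<close>

text \<open>A walk is never empty, so \<open>hd\<close> always makes sense, and \<open>E\<close> is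
  required from the newer vertex to the older one. Since \<open>E\<close> may relate a vertex to
  itself, loops are excluded by \<open>x \<noteq> y\<close>; the last clause forbids
  backtracking.\<close>

fun reduced_walk :: "('c \<Rightarrow> 'c \<Rightarrow> bool) \<Rightarrow> 'c list \<Rightarrow> bool" where
  "reduced_walk E [] = False"
| "reduced_walk E [x] = True"
| "reduced_walk E (x # y # s) =
    (E x y \<and> x \<noteq> y \<and> reduced_walk E (y # s) \<and> (s = [] \<or> hd s \<noteq> x))"

text \<open>Walks are stored with their current end at the head. Visiting \<open>x\<close> stays put, backtracks, or
  extends the walk.\<close>

definition push :: "'c \<Rightarrow> 'c list \<Rightarrow> 'c list" where
  "push x s = (if hd s = x then s else if tl s \<noteq> [] \<and> hd (tl s) = x then tl s else x # s)"

text \<open>Equality or adjacency in the tree: dropping the head of a walk gives its parent. The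
  root is a one-element list, whose tail \<open>[]\<close> is not a reduced walk.\<close>

definition tree_near :: "'c list \<Rightarrow> 'c list \<Rightarrow> bool" where
  "tree_near s t \<longleftrightarrow> s = t \<or> s = tl t \<or> t = tl s"

lemma reduced_walk_nonempty: "reduced_walk E s \<Longrightarrow> s \<noteq> []"
  by auto

lemma reduced_walk_push:
  assumes "reduced_walk E s" "E x (hd s)"
  shows "reduced_walk E (push x s)"
  using assms by (cases "(E, s)" rule: reduced_walk.cases) (auto simp: push_def)

lemma hd_push: "hd (push x s) = x"
  by (simp add: push_def)

lemma push_hd: "push (hd s) s = s"
  by (simp add: push_def)

text \<open>A step out and back lifts to a step out and back. If the first push shortens the walk,
  reducedness keeps the piece two steps back from being \<open>hd s\<close>, so the second push
  extends the walk again.\<close>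

lemma push_push_hd:
  assumes "reduced_walk E s"
  shows "push (hd s) (push x s) = s"
  using assms by (cases "(E, s)" rule: reduced_walk.cases) (auto simp: push_def)

lemma push_push_same: "push x (push x s) = push x s"
  by (simp add: push_def)

lemma tree_near_push: "tree_near s (push x s)"
  by (auto simp: push_def tree_near_def)

lemma reduced_walk_tl_edge:
  assumes "reduced_walk E s" "tl s \<noteq> []"
  shows "E (hd s) (hd (tl s))"
  using assms by (cases "(E, s)" rule: reduced_walk.cases) auto


section \<open>Word metrics\<close>

locale cayley_graph = group G for G (structure) +
  fixes S
  assumes fgs: "finite_generating_set G S"
begin

abbreviation "adj \<equiv> cayley_adj G S"
abbreviation "dS \<equiv> cayley_dist G S"

lemma S_carrier: "x \<in> S \<Longrightarrow> x \<in> carrier G"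
  using fgs by (auto simp: finite_generating_set_def)

lemma adj_sym: "(g, h) \<in> adj \<Longrightarrow> (h, g) \<in> adj"
  by (auto simp: cayley_adj_def)

lemma adj_left: "(g, h) \<in> adj \<Longrightarrow> a \<in> carrier G \<Longrightarrow> (a \<otimes> g, a \<otimes> h) \<in> adj"
  using S_carrier by (fastforce simp: cayley_adj_def m_assoc)

lemma relpow_sym: "(g, h) \<in> adj ^^ n \<Longrightarrow> (h, g) \<in> adj ^^ n"
proof (induction n arbitrary: h)
  case (Suc n)
  then obtain k where "(g, k) \<in> adj ^^ n" "(k, h) \<in> adj" by auto
  with Suc.IH adj_sym show ?case by (metis relpow_Suc_I2)
qed auto

lemma relpow_left: "(g, h) \<in> adj ^^ n \<Longrightarrow> a \<in> carrier G \<Longrightarrow> (a \<otimes> g, a \<otimes> h) \<in> adj ^^ n"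
proof (induction n arbitrary: h)
  case (Suc n)
  then obtain k where "(g, k) \<in> adj ^^ n" "(k, h) \<in> adj" by auto
  with Suc adj_left show ?case by (meson relpow_Suc_I)
qed auto

lemma relpow_append: "(x, y) \<in> adj ^^ n \<Longrightarrow> (y, z) \<in> adj ^^ k \<Longrightarrow> (x, z) \<in> adj ^^ (n + k)"
  by (auto simp: relpow_add)

text \<open>For a product, the path for the second factor starts where the first one ends, hence the
  arbitrary \<open>g\<close>. An inverse generator crosses an edge backwards.\<close>

lemma connected_generate:
  assumes "x \<in> generate G S" "g \<in> carrier G"
  shows "\<exists>n. (g, g \<otimes> x) \<in> adj ^^ n"
  using assms
proof (induction arbitrary: g)
  case one
  then show ?case by (intro exI[of _ 0]) simp
next
  case (incl h)
  then show ?case using S_carrier by (intro exI[of _ 1]) (auto simp: cayley_adj_def)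
next
  case (inv h)
  then have "g = g \<otimes> inv h \<otimes> h" "g \<otimes> inv h \<in> carrier G" using S_carrier by (simp_all add: m_assoc)
  with inv have "(g, g \<otimes> inv h) \<in> adj" unfolding cayley_adj_def by blast
  then show ?case by (metis relpow_1)
next
  case (eng h1 h2)
  have c: "h1 \<in> carrier G" "h2 \<in> carrier G"
    using eng.hyps fgs by (auto simp: finite_generating_set_def)
  obtain n where "(g, g \<otimes> h1) \<in> adj ^^ n" using eng by blast
  moreover obtain k where "(g \<otimes> h1, g \<otimes> h1 \<otimes> h2) \<in> adj ^^ k" using eng c by blast
  ultimately show ?case using c eng.prems relpow_append by (fastforce simp: m_assoc)
qed

text \<open>Since the graph is connected, the \<open>LEAST\<close> in \<open>cayley_dist\<close> is
  attained.\<close>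

lemma dist_relpow:
  assumes "x \<in> carrier G" "y \<in> carrier G"
  shows "(x, y) \<in> adj ^^ dS x y"
proof -
  have "\<exists>n. (x, x \<otimes> (inv x \<otimes> y)) \<in> adj ^^ n"
    using assms fgs by (intro connected_generate) (auto simp: finite_generating_set_def)
  moreover have "x \<otimes> (inv x \<otimes> y) = y" using assms by (simp add: m_assoc[symmetric])
  ultimately show ?thesis unfolding cayley_dist_def by (metis LeastI_ex)
qed

lemma dist_le: "(x, y) \<in> adj ^^ n \<Longrightarrow> dS x y \<le> n"
  unfolding cayley_dist_def by (rule Least_le)

lemma dist_self: "dS x x = 0"
  using dist_le[of x x 0] by simp

lemma dist_sym: "x \<in> carrier G \<Longrightarrow> y \<in> carrier G \<Longrightarrow> dS x y = dS y x"
  by (meson antisym dist_le relpow_sym dist_relpow)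

lemma dist_triangle:
  "x \<in> carrier G \<Longrightarrow> y \<in> carrier G \<Longrightarrow> z \<in> carrier G \<Longrightarrow> dS x z \<le> dS x y + dS y z"
  by (meson dist_le relpow_append dist_relpow)

lemma dist_left_le:
  "x \<in> carrier G \<Longrightarrow> y \<in> carrier G \<Longrightarrow> a \<in> carrier G \<Longrightarrow> dS (a \<otimes> x) (a \<otimes> y) \<le> dS x y"
  by (intro dist_le relpow_left dist_relpow)

lemma dist_le_1:
  assumes "x \<in> carrier G" "y \<in> carrier G" "dS x y \<le> 1"
  shows "x = y \<or> (\<exists>s\<in>S. y = x \<otimes> s \<or> y = x \<otimes> inv s)"
proof -
  consider "dS x y = 0" | "dS x y = 1" using assms(3) by linarith
  then show ?thesis
  proof cases
    case 1
    then show ?thesis using dist_relpow[OF assms(1,2)] by simp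
  next
    case 2
    then have "(x, y) \<in> adj" using dist_relpow[OF assms(1,2)] by simp
    then obtain s where "s \<in> S" "y = x \<otimes> s \<or> x = y \<otimes> s" by (auto simp: cayley_adj_def)
    then show ?thesis using assms S_carrier inv_solve_right by metis
  qed
qed

end

text \<open>Each \<open>T\<close>-edge can be replaced by an \<open>S\<close>-path of length at most
  the largest \<open>S\<close>-length of an element of \<open>T\<close>. This passes from the
  generating set that witnesses the dimension to the given one.\<close>

lemma cayley_dist_bound:
  assumes "cayley_graph G S" "cayley_graph G T"
  shows "\<exists>C. \<forall>x\<in>carrier G. \<forall>y\<in>carrier G. cayley_dist G S x y \<le> C * cayley_dist G T x y"
proof -
  interpret S: cayley_graph G S by fact
  interpret T: cayley_graph G T by fact
  have fin: "finite T" using T.fgs by (simp add: finite_generating_set_def)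
  \<comment> \<open>The inserted 0 keeps \<open>Max\<close> meaningful when \<open>T\<close> is
    empty.\<close>
  define C where "C = Max (insert 0 (S.dS \<one>\<^bsub>G\<^esub> ` T))"
  have gen: "S.dS \<one>\<^bsub>G\<^esub> t \<le> C" if "t \<in> T" for t
    unfolding C_def using fin that by (intro Max_ge) auto
  have right: "S.dS g (g \<otimes>\<^bsub>G\<^esub> t) \<le> C" if "t \<in> T" "g \<in> carrier G" for g t
    using S.dist_left_le[of "\<one>\<^bsub>G\<^esub>" t g] gen[of t] that T.S_carrier by simp
  have adj: "S.dS g h \<le> C" if "(g, h) \<in> T.adj" for g h
    using that right S.dist_sym by (fastforce simp: cayley_adj_def)
  have pow: "S.dS g h \<le> C * n" if "(g, h) \<in> T.adj ^^ n" "g \<in> carrier G" for g h n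
    using that
  proof (induction n arbitrary: h)
    case 0
    then show ?case by (simp add: S.dist_self)
  next
    case (Suc n)
    then obtain k where k: "(g, k) \<in> T.adj ^^ n" "(k, h) \<in> T.adj" by auto
    then have "k \<in> carrier G" "h \<in> carrier G" by (auto simp: cayley_adj_def)
    then have "S.dS g h \<le> S.dS g k + S.dS k h" using Suc.prems by (intro S.dist_triangle)
    also have "\<dots> \<le> C * n + C" using Suc k adj by (intro add_mono) auto
    finally show ?case by simp
  qed
  then show ?thesis using T.dist_relpow by blast
qed


section \<open>Triangulating sequences over a tree\<close>

text \<open>A neighbour that is no higher than \<open>u\<close> is \<open>u\<close> itself or its
  unique parent \<open>tl u\<close>, and any two of these are equal or adjacent.\<close>

lemma tree_near_peak:
  assumes "tree_near s u" "tree_near u t" "length s \<le> length u" "length t \<le> length u" "u \<noteq> []"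
  shows "tree_near s t"
proof -
  have *: "a = u \<or> a = tl u" if "tree_near a u \<or> tree_near u a" "length a \<le> length u" for a
    using that \<open>u \<noteq> []\<close> by (cases a) (auto simp: tree_near_def)
  have "s = u \<or> s = tl u" "t = u \<or> t = tl u"
    using * assms by blast+
  then show ?thesis by (auto simp: tree_near_def)
qed

text \<open>Nearness of consecutive tree images implies, by \<open>near\<close>, that the sequence
  is an \<open>M\<close>-sequence. Unlike the latter property, it survives the deletion of a peak
  without loss, so it is the invariant of the induction.\<close>

lemma triangulable_of_tree_map:
  assumes near: "\<And>x y. x \<in> carrier G \<Longrightarrow> y \<in> carrier G \<Longrightarrow> tree_near (t x) (t y) \<Longrightarrow> cayley_dist G S x y \<le> M"
    and nonempty: "\<And>x. x \<in> carrier G \<Longrightarrow> t x \<noteq> []"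
    and base: "length (t b) = 1"
    and "vs \<noteq> []" "set vs \<subseteq> carrier G" "hd vs = b" "last vs = b"
    and "\<And>i. i + 1 < length vs \<Longrightarrow> tree_near (t (vs ! i)) (t (vs ! (i + 1)))"
  shows "m_triangulable G S M vs"
  using assms(4-)
proof (induction "length vs" arbitrary: vs rule: less_induct)
  case less
  have car: "vs ! i \<in> carrier G" if "i < length vs" for i
    using less.prems(2) that by auto
  have seq: "m_sequence G S M vs"
    unfolding m_sequence_def using less.prems near car by auto
  show ?case
  proof (cases "length vs \<le> 4")
    case True
    then show ?thesis using seq by (intro m_triangulable.short) auto
  next
    case False
    define n where "n = length vs - 1"
    have n: "length vs = n + 1" "n \<ge> 4" using False by (auto simp: n_def)
    have ends: "vs ! 0 = b" "vs ! n = b"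
      using less.prems n by (auto simp: hd_conv_nth last_conv_nth)
    define I where "I = {1..<n}"
    have "finite I" "I \<noteq> {}" using n by (auto simp: I_def)
    then obtain i where i: "i \<in> I" "\<And>j. j \<in> I \<Longrightarrow> length (t (vs ! j)) \<le> length (t (vs ! i))"
      using finite_has_maximal[of "(\<lambda>j. length (t (vs ! j))) ` I"] by force
    have i1: "1 \<le> i" "i < n" using i by (auto simp: I_def)
    have ne: "t (vs ! i) \<noteq> []" using nonempty car i1 n by simp
    \<comment> \<open>Both ends have height 1, the least height of a nonempty walk, so the interior
      maximum dominates them as well.\<close>
    have peak: "length (t (vs ! j)) \<le> length (t (vs ! i))" if "j \<le> n" for j
    proof (cases "j \<in> I")
      case False
      then have "vs ! j = b" using that ends by (cases "j = 0") (auto simp: I_def)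
      then show ?thesis using base ne by (simp add: Suc_leI)
    qed (use i in blast)
    have nr: "tree_near (t (vs ! (i - 1))) (t (vs ! (i + 1)))"
    proof (rule tree_near_peak)
      show "tree_near (t (vs ! (i - 1))) (t (vs ! i))" using less.prems(5)[of "i - 1"] i1 n by simp
      show "tree_near (t (vs ! i)) (t (vs ! (i + 1)))" using less.prems(5)[of i] i1 n by simp
    qed (use peak i1 ne in auto)
    define ws where "ws = take i vs @ drop (i + 1) vs"
    have wn: "ws ! j = (if j < i then vs ! j else vs ! (j + 1))" if "j < n" for j
      using that n i1 by (auto simp: ws_def nth_append)
    have lw: "length ws = n" using n i1 by (simp add: ws_def)
    have "m_reduction G S M vs ws"
      unfolding m_reduction_def
    proof (intro exI conjI)
      show "cayley_dist G S (vs ! (i - 1)) (vs ! (i + 1)) \<le> M"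
        using nr car i1 n by (intro near) auto
    qed (use i1 n ws_def in auto)
    moreover have "m_triangulable G S M ws"
    proof (rule less.hyps)
      show "length ws < length vs" using lw n by simp
      show "ws \<noteq> []" using lw n by auto
      show "set ws \<subseteq> carrier G"
        using less.prems(2) by (auto simp: ws_def dest: in_set_takeD in_set_dropD)
      show "hd ws = b" using \<open>ws \<noteq> []\<close> wn[of 0] i1 ends by (simp add: hd_conv_nth)
      show "last ws = b" using \<open>ws \<noteq> []\<close> wn[of "n - 1"] i1 ends lw by (simp add: last_conv_nth)
      fix j assume j: "j + 1 < length ws"
      \<comment> \<open>Only the pair straddling the deleted entry is new; \<open>nr\<close> covers
        it.\<close>
      consider "j + 1 < i" | "j + 1 = i" | "i \<le> j" by linarith
      then show "tree_near (t (ws ! j)) (t (ws ! (j + 1)))"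
      proof cases
        case 1
        then have "ws ! j = vs ! j" "ws ! (j + 1) = vs ! (j + 1)" using wn j lw by auto
        then show ?thesis using j lw n less.prems(5)[of j] by (metis add_lessD1 add_strict_right_mono)
      next
        case 2
        then have "j = i - 1" by simp
        then show ?thesis using 2 nr wn[of j] wn[of "j + 1"] j lw by simp
      next
        case 3
        then have "ws ! j = vs ! (j + 1)" "ws ! (j + 1) = vs ! (j + 1 + 1)" using wn j lw by auto
        then show ?thesis using j lw n less.prems(5)[of "j + 1"] by (metis add_strict_right_mono)
      qed
    qed
    ultimately show ?thesis using seq m_triangulable.reduce by metis
  qed
qed


section \<open>Presentations\<close>

lemma words_take: "w \<in> words X \<Longrightarrow> take k w \<in> words X"
  by (auto simp: words_def dest: in_set_takeD)

lemma class_in_free_group: "w \<in> words X \<Longrightarrow> free_eq X `` {w} \<in> carrier (free_group X)"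
  by (auto simp: free_group_def quotient_def)

lemma free_group_class_exhaust:
  assumes "A \<in> carrier (free_group X)"
  obtains w where "w \<in> words X" "A = free_eq X `` {w}"
  using assms by (auto simp: free_group_def quotient_def)

lemma normal_normal_closure:
  assumes "group F" "R \<subseteq> carrier F"
  shows "normal_closure F R \<lhd> F"
proof -
  interpret F: group F by fact
  \<comment> \<open>The family to be intersected must be nonempty, as the empty intersection would
    be \<open>UNIV\<close>.\<close>
  have "carrier F \<lhd> F"
    by (rule F.normal_invI) (auto intro: F.subgroup_self)
  then have ne: "{N. N \<lhd> F \<and> R \<subseteq> N} \<noteq> {}" using assms by auto
  show ?thesis
    unfolding normal_closure_def
  proof (rule F.normal_invI)
    show "subgroup (\<Inter>{N. N \<lhd> F \<and> R \<subseteq> N}) F"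
      by (rule F.subgroups_Inter) (use ne F.normal_inv_iff in auto)
  qed (auto simp: F.normal_inv_iff)
qed

text \<open>The map \<open>f\<close> is the projection to the quotient followed by the inverse of
  the given isomorphism; injectivity of the latter keeps the kernel equal to the normal
  closure.\<close>

lemma finitely_presentable_cover:
  assumes "group G" "finitely_presentable G"
  obtains n :: nat and R f where
    "finite R" "R \<subseteq> carrier (free_group {..<n})" "f \<in> hom (free_group {..<n}) G"
    "f ` carrier (free_group {..<n}) = carrier G"
    "kernel (free_group {..<n}) G f = normal_closure (free_group {..<n}) R"
proof -
  obtain n :: nat and R where R: "finite R" "R \<subseteq> carrier (free_group {..<n})"
      "G \<cong> free_group {..<n} Mod normal_closure (free_group {..<n}) R"
    using assms(2) by (auto simp: finitely_presentable_def)
  define F where "F = free_group {..<n}"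
  define N where "N = normal_closure F R"
  interpret G: group G by fact
  interpret F: group F unfolding F_def by (rule group_free_group)
  interpret N: normal N F
    unfolding N_def by (rule normal_normal_closure) (use R F_def F.is_group in auto)
  interpret Q: group "F Mod N" by (rule N.factorgroup_is_group)
  obtain \<psi> where "\<psi> \<in> iso G (F Mod N)"
    using R(3) by (auto simp: is_iso_def F_def N_def)
  then have "inv_into (carrier G) \<psi> \<in> iso (F Mod N) G" by (rule G.iso_set_sym)
  then obtain h where h: "h \<in> hom (F Mod N) G" "bij_betw h (carrier (F Mod N)) (carrier G)"
    by (auto simp: iso_def)
  define f where "f = h \<circ> (\<lambda>a. N #>\<^bsub>F\<^esub> a)"
  have "f \<in> hom F G"
    unfolding f_def by (rule hom_compose[OF N.r_coset_hom_Mod h(1)])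
  moreover have "f ` carrier F = carrier G"
  proof -
    have "(\<lambda>a. N #>\<^bsub>F\<^esub> a) ` carrier F = carrier (F Mod N)"
      by (auto simp: FactGroup_def RCOSETS_def)
    then show ?thesis using h(2) by (simp only: f_def image_comp[symmetric] bij_betw_def)
  qed
  moreover have "kernel F G f = N"
  proof (intro equalityI subsetI)
    have h1: "h \<one>\<^bsub>F Mod N\<^esub> = \<one>\<^bsub>G\<^esub>" using h(1) by (intro hom_one) auto
    show "a \<in> kernel F G f" if "a \<in> N" for a
      using that h1 N.subset F.coset_join2[OF _ N.subgroup_axioms that]
      by (auto simp: kernel_def f_def)
    fix a assume "a \<in> kernel F G f"
    then have a: "a \<in> carrier F" "h (N #>\<^bsub>F\<^esub> a) = \<one>\<^bsub>G\<^esub>" by (auto simp: kernel_def f_def)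
    have "N #>\<^bsub>F\<^esub> a \<in> carrier (F Mod N)"
      using a by (auto simp: FactGroup_def RCOSETS_def)
    then have "N #>\<^bsub>F\<^esub> a = \<one>\<^bsub>F Mod N\<^esub>"
      using a h(2) h1 by (metis bij_betw_def inj_onD Q.one_closed)
    then have "N #>\<^bsub>F\<^esub> a = N" by simp
    then show "a \<in> N" using a F.coset_join1 N.subgroup_axioms by blast
  qed
  ultimately show thesis using that R F_def N_def by blast
qed


section \<open>Lifting to the universal cover of the nerve\<close>

text \<open>Here \<open>p\<close> gives the piece of an element and \<open>E\<close> the edges of
  the nerve, directed from the piece entered to the piece left, as in
  \<open>reduced_walk\<close>.\<close>

locale free_cover = group G for G (structure) +
  fixes X :: "'x set" and f :: "'x word set \<Rightarrow> 'a" and p :: "'a \<Rightarrow> 'c"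
    and E :: "'c \<Rightarrow> 'c \<Rightarrow> bool"
  assumes hom: "f \<in> hom (free_group X) G"
    and surj: "f ` carrier (free_group X) = carrier G"
    and edge: "\<lbrakk>g \<in> carrier G; x \<in> X\<rbrakk> \<Longrightarrow> E (p (g \<otimes> f (free_eq X `` {[(x, b)]}))) (p g)"
begin

abbreviation "F \<equiv> free_group X"

sublocale F: group F by (rule group_free_group)

sublocale f: group_hom F G f
  by unfold_locales (rule hom)

definition ev :: "'x word \<Rightarrow> 'a" where
  "ev w = f (free_eq X `` {w})"

text \<open>Path lifting: the word traces a path in \<open>G\<close>, and the walk follows the
  pieces it meets.\<close>

definition act :: "'a \<times> 'c list \<Rightarrow> 'x word \<Rightarrow> 'a \<times> 'c list" where
  "act = foldl (\<lambda>(g, s) a. (g \<otimes> ev [a], push (p (g \<otimes> ev [a])) s))"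

text \<open>The fibre product, over the pieces, of \<open>G\<close> with the tree vertices, all base
  pieces being allowed at once.\<close>

definition states :: "('a \<times> 'c list) set" where
  "states = {(g, s). g \<in> carrier G \<and> reduced_walk E s \<and> hd s = p g}"

text \<open>The piece \<open>V\<close> may depend on \<open>g\<close> but not on the prefix: each
  translate of the path meets at most two pieces.\<close>

definition narrow :: "'x word \<Rightarrow> bool" where
  "narrow w \<longleftrightarrow> (\<forall>g\<in>carrier G. \<exists>V. \<forall>k\<le>length w. p (g \<otimes> ev (take k w)) \<in> {p g, V})"

lemma ev_closed: "w \<in> words X \<Longrightarrow> ev w \<in> carrier G"
  by (simp add: ev_def class_in_free_group)

lemma ev_append: "u \<in> words X \<Longrightarrow> v \<in> words X \<Longrightarrow> ev (u @ v) = ev u \<otimes> ev v"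
  by (simp add: ev_def free_group_mult[symmetric] class_in_free_group)

lemma ev_Nil: "ev [] = \<one>"
proof -
  have "free_eq X `` {[]} = \<one>\<^bsub>F\<^esub>" by (simp add: free_group_def)
  then show ?thesis unfolding ev_def by (metis f.hom_one)
qed

lemma ev_cong: "(u, v) \<in> free_eq X \<Longrightarrow> ev u = ev v"
  unfolding ev_def using equiv_class_eq[OF equiv_free_eq] by metis

lemma ev_surj:
  assumes "g \<in> carrier G"
  shows "\<exists>w\<in>words X. ev w = g"
  using assms surj unfolding ev_def by (metis imageE free_group_class_exhaust)

lemma letter_words: "x \<in> X \<Longrightarrow> [(x, b)] \<in> words X"
  by (simp add: words_def)

lemma ev_cancel:
  assumes "x \<in> X"
  shows "ev [(x, b)] \<otimes> ev [(x, \<not> b)] = \<one>"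
  using ev_cong[of "[(x, b), (x, \<not> b)]" "[]"] free_eq.cancel[of "[]" X "[]" x b] assms
    ev_append[OF letter_words[of x b] letter_words[of x "\<not> b"]]
  by (simp add: ev_Nil words_def)

lemma act_Nil: "act z [] = z"
  by (simp add: act_def)

lemma act_append: "act z (u @ v) = act (act z u) v"
  by (simp add: act_def)

lemma act_letter: "act (g, s) [a] = (g \<otimes> ev [a], push (p (g \<otimes> ev [a])) s)"
  by (simp add: act_def)

lemma act_states:
  assumes "w \<in> words X" "z \<in> states"
  shows "act z w \<in> states"
  using assms
proof (induction w rule: rev_induct)
  case (snoc a w)
  obtain x b where a: "a = (x, b)" "x \<in> X" "w \<in> words X"
    using snoc.prems by (cases a) (auto simp: words_def)
  obtain g s where gs: "act z w = (g, s)" by fastforce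
  with snoc a have st: "g \<in> carrier G" "reduced_walk E s" "hd s = p g" by (auto simp: states_def)
  have "E (p (g \<otimes> ev [a])) (hd s)" using edge[OF st(1) a(2)] st a by (simp add: ev_def)
  then show ?case
    using st a ev_closed[OF letter_words]
    by (simp add: act_append gs act_letter states_def hd_push reduced_walk_push)
qed (simp add: act_Nil)

lemma fst_act:
  assumes "w \<in> words X" "fst z \<in> carrier G"
  shows "fst (act z w) = fst z \<otimes> ev w"
  using assms
proof (induction w rule: rev_induct)
  case (snoc a w)
  then have w: "w \<in> words X" "[a] \<in> words X" by (auto simp: words_def)
  obtain g s where gs: "act z w = (g, s)" by fastforce
  with snoc w have "g = fst z \<otimes> ev w" by (metis fst_conv)
  then show ?case using w snoc.prems by (simp add: act_append gs act_letter ev_append ev_closed m_assoc)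
qed (simp add: act_Nil ev_Nil)

text \<open>The second letter returns to \<open>g\<close>, whose piece is \<open>hd s\<close>, so
  \<open>push_push_hd\<close> applies.\<close>

lemma act_cancel:
  assumes "x \<in> X" "z \<in> states"
  shows "act z [(x, b), (x, \<not> b)] = z"
proof -
  obtain g s where z: "z = (g, s)" "g \<in> carrier G" "reduced_walk E s" "hd s = p g"
    using assms by (auto simp: states_def)
  have "g \<otimes> ev [(x, b)] \<otimes> ev [(x, \<not> b)] = g"
    using z assms by (simp add: m_assoc ev_closed letter_words ev_cancel)
  then show ?thesis
    using z act_append[of z "[(x, b)]" "[(x, \<not> b)]"] push_push_hd[OF z(3)]
    by (simp add: act_letter)
qed

text \<open>A cancelling pair inside a word fixes the state reached there. Hence \<open>act\<close>
  descends to a right action of the free group on \<open>states\<close>.\<close>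

lemma act_cong:
  assumes "(u, v) \<in> free_eq X" "z \<in> states"
  shows "act z u = act z v"
  using assms
proof (induction arbitrary: z)
  case (cancel u v x b)
  then show ?case
    using act_cancel[OF cancel.hyps(3), of "act z u" b] act_states
    by (simp only: act_append)
qed auto

text \<open>By \<open>push_push_hd\<close> and \<open>push_push_same\<close>, a path meeting only the pieces \<open>U = hd s\<close> and
  \<open>V\<close> lifts into the edge of the tree between \<open>s\<close> and \<open>push V s\<close>.\<close>

lemma act_narrow:
  assumes "w \<in> words X" "narrow w" "(g, s) \<in> states"
  shows "act (g, s) w = (g \<otimes> ev w, push (p (g \<otimes> ev w)) s)"
proof -
  have g: "g \<in> carrier G" "reduced_walk E s" "hd s = p g" using assms by (auto simp: states_def)
  obtain V where V: "\<And>k. k \<le> length w \<Longrightarrow> p (g \<otimes> ev (take k w)) \<in> {p g, V}"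
    using assms g unfolding narrow_def by blast
  have "act (g, s) (take k w) = (g \<otimes> ev (take k w), push (p (g \<otimes> ev (take k w))) s)"
    if "k \<le> length w" for k
    using that
  proof (induction k)
    case 0
    then show ?case using g push_hd[of s] by (simp add: act_Nil ev_Nil)
  next
    case (Suc k)
    let ?a = "w ! k"
    have tk: "take (Suc k) w = take k w @ [?a]" using Suc.prems by (simp add: take_Suc_conv_app_nth)
    have wd: "take k w \<in> words X" "[?a] \<in> words X"
      using words_take[OF assms(1), of "Suc k"] by (simp_all add: tk words_append)
    have "g \<otimes> ev (take k w) \<otimes> ev [?a] = g \<otimes> ev (take (Suc k) w)"
      using wd g by (simp add: tk ev_append ev_closed m_assoc)
    moreover have "push U (push V' s) = push U s" if "U \<in> {p g, V}" "V' \<in> {p g, V}" for U V'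
      using that push_hd[of s] push_push_hd[OF g(2)] push_push_same g(3) by (metis empty_iff insert_iff)
    ultimately show ?case
      using Suc V[of k] V[of "Suc k"] by (simp add: tk act_append act_letter)
  qed
  from this[of "length w"] show ?thesis by simp
qed

text \<open>The kernel of the action of the free group on \<open>states\<close>.\<close>

definition trivial_classes :: "'x word set set" where
  "trivial_classes = {A \<in> carrier F. \<forall>w\<in>A. \<forall>z\<in>states. act z w = z}"

lemma trivial_classes_iff:
  assumes "w \<in> words X"
  shows "free_eq X `` {w} \<in> trivial_classes \<longleftrightarrow> (\<forall>z\<in>states. act z w = z)"
proof
  show "\<forall>z\<in>states. act z w = z" if "free_eq X `` {w} \<in> trivial_classes"
    using that free_eq.refl[OF assms] unfolding trivial_classes_def by blast
  show "free_eq X `` {w} \<in> trivial_classes" if "\<forall>z\<in>states. act z w = z"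
    unfolding trivial_classes_def
  proof (intro CollectI conjI ballI class_in_free_group assms)
    fix v z assume "v \<in> free_eq X `` {w}" "z \<in> states"
    then have "act z w = act z v" by (intro act_cong) auto
    with that \<open>z \<in> states\<close> show "act z v = z" by simp
  qed
qed

lemma class_inverse:
  assumes "u \<in> words X"
  obtains v where "v \<in> words X" "inv\<^bsub>F\<^esub> (free_eq X `` {u}) = free_eq X `` {v}"
    "\<And>z. z \<in> states \<Longrightarrow> act (act z u) v = z" "\<And>z. z \<in> states \<Longrightarrow> act (act z v) u = z"
proof -
  let ?A = "free_eq X `` {u}"
  have A: "?A \<in> carrier F" using assms by (rule class_in_free_group)
  then obtain v where v: "v \<in> words X" "inv\<^bsub>F\<^esub> ?A = free_eq X `` {v}"
    using free_group_class_exhaust F.inv_closed by metis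
  have nil: "[] \<in> words X" "\<one>\<^bsub>F\<^esub> = free_eq X `` {[]}" by (simp_all add: words_def free_group_def)
  have "free_eq X `` {u @ v} = free_eq X `` {[]}" "free_eq X `` {v @ u} = free_eq X `` {[]}"
    using F.r_inv[OF A] F.l_inv[OF A] assms v nil by (simp_all add: free_group_mult)
  then have "(u @ v, []) \<in> free_eq X" "(v @ u, []) \<in> free_eq X"
    using nil eq_equiv_class[OF _ equiv_free_eq] by blast+
  then have "act (act z u) v = z" "act (act z v) u = z" if "z \<in> states" for z
    using that act_cong by (metis act_append act_Nil)+
  with v that show thesis by blast
qed

text \<open>For a conjugate, the state reached along \<open>u\<close> is fixed by \<open>w\<close>,
  and \<open>v\<close> then undoes \<open>u\<close>.\<close>

lemma trivial_classes_normal: "trivial_classes \<lhd> F"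
proof (rule F.normal_invI)
  have nil: "[] \<in> words X" "\<one>\<^bsub>F\<^esub> = free_eq X `` {[]}" by (simp_all add: words_def free_group_def)
  have car: "A \<in> carrier F" if "A \<in> trivial_classes" for A
    using that by (simp add: trivial_classes_def)
  show "subgroup trivial_classes F"
  proof (rule F.subgroupI)
    show "trivial_classes \<subseteq> carrier F" using car by blast
    show "trivial_classes \<noteq> {}"
      using trivial_classes_iff[OF nil(1)] by (auto simp: act_Nil)
    fix A assume A: "A \<in> trivial_classes"
    obtain u where u: "u \<in> words X" "A = free_eq X `` {u}"
      using car[OF A] by (rule free_group_class_exhaust)
    have Au: "\<forall>z\<in>states. act z u = z" using A u trivial_classes_iff by blast
    obtain v where "v \<in> words X" "inv\<^bsub>F\<^esub> A = free_eq X `` {v}"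
        "\<And>z. z \<in> states \<Longrightarrow> act (act z u) v = z"
      using class_inverse[OF u(1)] u(2) by metis
    then show "inv\<^bsub>F\<^esub> A \<in> trivial_classes" using Au trivial_classes_iff by metis
    fix B assume B: "B \<in> trivial_classes"
    obtain w where "w \<in> words X" "B = free_eq X `` {w}"
      using car[OF B] by (rule free_group_class_exhaust)
    then show "A \<otimes>\<^bsub>F\<^esub> B \<in> trivial_classes"
      using u Au B trivial_classes_iff by (simp add: free_group_mult words_append act_append)
  qed
  fix A B assume A: "A \<in> carrier F" and B: "B \<in> trivial_classes"
  obtain u where u: "u \<in> words X" "A = free_eq X `` {u}"
    using A by (rule free_group_class_exhaust)
  obtain w where w: "w \<in> words X" "B = free_eq X `` {w}"
    using car[OF B] by (rule free_group_class_exhaust)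
  obtain v where v: "v \<in> words X" "inv\<^bsub>F\<^esub> A = free_eq X `` {v}"
      "\<And>z. z \<in> states \<Longrightarrow> act (act z u) v = z"
    using class_inverse[OF u(1)] u(2) by metis
  have "\<forall>z\<in>states. act z ((u @ w) @ v) = z"
    using B w u v act_states trivial_classes_iff by (simp add: act_append)
  moreover have "A \<otimes>\<^bsub>F\<^esub> B \<otimes>\<^bsub>F\<^esub> inv\<^bsub>F\<^esub> A = free_eq X `` {(u @ w) @ v}"
    using u v w by (simp add: free_group_mult words_append)
  ultimately show "A \<otimes>\<^bsub>F\<^esub> B \<otimes>\<^bsub>F\<^esub> inv\<^bsub>F\<^esub> A \<in> trivial_classes"
    using trivial_classes_iff[of "(u @ w) @ v"] u v w by (simp add: words_append)
qed

text \<open>Loops in \<open>G\<close> lift to loops: narrow relators act trivially, and the kernel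
  of the action, being normal, contains their normal closure.\<close>

lemma act_relator:
  assumes "kernel F G f \<subseteq> normal_closure F R" "R \<subseteq> carrier F"
    and "\<And>A. A \<in> R \<Longrightarrow> \<exists>w\<in>words X. A = free_eq X `` {w} \<and> ev w = \<one> \<and> narrow w"
    and "w \<in> words X" "ev w = \<one>" "z \<in> states"
  shows "act z w = z"
proof -
  have "R \<subseteq> trivial_classes"
  proof
    fix A assume "A \<in> R"
    then obtain r where r: "r \<in> words X" "A = free_eq X `` {r}" "ev r = \<one>" "narrow r"
      using assms(3) by blast
    \<comment> \<open>By \<open>act_narrow\<close> the lift ends in \<open>push (p g) s\<close>,
      which is \<open>s\<close> because \<open>hd s = p g\<close>.\<close>
    have "act z r = z" if "z \<in> states" for z
      using that act_narrow[OF r(1,4), of "fst z" "snd z"] push_hd[of "snd z"] r(3)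
      by (auto simp: states_def)
    then show "A \<in> trivial_classes" using r trivial_classes_iff by simp
  qed
  then have "normal_closure F R \<subseteq> trivial_classes"
    using trivial_classes_normal unfolding normal_closure_def by blast
  moreover have "free_eq X `` {w} \<in> kernel F G f"
    using assms(4,5) class_in_free_group by (auto simp: kernel_def ev_def)
  ultimately show ?thesis using assms trivial_classes_iff by blast
qed

text \<open>The vertex \<open>t x\<close> is where the lift of any word leading from
  \<open>b\<close> to \<open>x\<close> ends when it starts at the root \<open>[p b]\<close>.\<close>

lemma tree_map_exists:
  assumes rel: "\<And>w z. w \<in> words X \<Longrightarrow> ev w = \<one> \<Longrightarrow> z \<in> states \<Longrightarrow> act z w = z"
    and b: "b \<in> carrier G"
  shows "\<exists>t. t b = [p b] \<and> (\<forall>x\<in>carrier G. reduced_walk E (t x) \<and> hd (t x) = p x) \<and>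
    (\<forall>x\<in>carrier G. \<forall>v\<in>words X. narrow v \<longrightarrow> t (x \<otimes> ev v) = push (p (x \<otimes> ev v)) (t x))"
proof -
  \<comment> \<open>If \<open>v'\<close> undoes \<open>v\<close>, then \<open>u @ v'\<close> has
    value one and acts trivially, so \<open>u\<close> and \<open>v\<close> act alike.\<close>
  have well_def: "act z u = act z v"
    if u: "u \<in> words X" and v: "v \<in> words X" and eq: "ev u = ev v" and z: "z \<in> states" for u v z
  proof -
    obtain v' where v': "v' \<in> words X" "\<And>z. z \<in> states \<Longrightarrow> act (act z v) v' = z"
        "\<And>z. z \<in> states \<Longrightarrow> act (act z v') v = z"
      using class_inverse[OF v] by metis
    have "fst z \<otimes> ev (v @ v') = fst z"
      using fst_act[of "v @ v'" z] v v' z by (auto simp: words_append act_append states_def)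
    then have "ev (v @ v') = \<one>"
      using z v v' ev_closed[of "v @ v'"] by (auto simp: words_append states_def)
    then have "ev (u @ v') = \<one>" using u v v' eq by (simp add: ev_append)
    then have "act (act z u) v' = z" using rel[of "u @ v'" z] u v' z by (simp add: words_append act_append)
    then show ?thesis using v'(3)[of "act z u"] act_states[OF u z] by simp
  qed
  define z0 where "z0 = (b, [p b])"
  have z0: "z0 \<in> states" using b by (simp add: z0_def states_def)
  define wd where "wd x = (SOME w. w \<in> words X \<and> ev w = inv b \<otimes> x)" for x
  have wd: "wd x \<in> words X" "ev (wd x) = inv b \<otimes> x" if "x \<in> carrier G" for x
    using someI_ex[of "\<lambda>w. w \<in> words X \<and> ev w = inv b \<otimes> x"] ev_surj[of "inv b \<otimes> x"] that b
    by (auto simp: wd_def)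
  define t where "t x = snd (act z0 (wd x))" for x
  have act_wd: "act z0 (wd x) = (x, t x)" if "x \<in> carrier G" for x
  proof -
    have "fst (act z0 (wd x)) = x"
      using fst_act[of "wd x" z0] wd[OF that] that b by (simp add: z0_def m_assoc[symmetric])
    then show ?thesis by (simp add: t_def prod_eq_iff)
  qed
  have states: "(x, t x) \<in> states" if "x \<in> carrier G" for x
    using act_states[OF wd(1)[OF that] z0] act_wd[OF that] by simp
  have "act z0 (wd b) = z0" using rel wd b z0 by simp
  then have "t b = [p b]" by (simp add: t_def z0_def)
  moreover have "t (x \<otimes> ev v) = push (p (x \<otimes> ev v)) (t x)"
    if x: "x \<in> carrier G" and v: "v \<in> words X" "narrow v" for x v
  proof -
    let ?y = "x \<otimes> ev v"
    have y: "?y \<in> carrier G" using x v ev_closed by simp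
    \<comment> \<open>Both words lead from \<open>b\<close> to \<open>?y\<close>, so their lifts end
      in the same state.\<close>
    have "ev (wd ?y) = ev (wd x @ v)"
      using wd[OF y] wd[OF x] x v b by (simp add: ev_append ev_closed m_assoc)
    then have "(?y, t ?y) = act (act z0 (wd x)) v"
      using well_def[of "wd ?y" "wd x @ v" z0] wd[OF y] wd[OF x] v z0 act_wd[OF y]
      by (simp add: words_append act_append)
    also have "\<dots> = (?y, push (p ?y) (t x))"
      using act_narrow[OF v states[OF x]] act_wd[OF x] by simp
    finally show ?thesis by simp
  qed
  ultimately show ?thesis using states by (intro exI[of _ t]) (auto simp: states_def)
qed

end


section \<open>Asymptotic dimension one\<close>

text \<open>Distinct pieces containing points at distance at most \<open>m\<close> have different
  colours; with two colours, three pairwise close points cannot lie in three distinct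
  pieces.\<close>

lemma asdim_le_1_map:
  fixes M :: "'a set" and d :: "'a \<Rightarrow> 'a \<Rightarrow> real"
  assumes "asdim_le M d 1" "m > 0" and nonneg: "\<And>x y. 0 \<le> d x y"
  obtains p :: "'a \<Rightarrow> 'a set" and D where
    "\<And>x y. \<lbrakk>x \<in> M; y \<in> M; p x = p y\<rbrakk> \<Longrightarrow> d x y \<le> D"
    "\<And>x y z. \<lbrakk>x \<in> M; y \<in> M; z \<in> M; d x y \<le> m; d y z \<le> m; d x z \<le> m\<rbrakk>
      \<Longrightarrow> p x = p y \<or> p y = p z \<or> p x = p z"
proof -
  obtain P D c where P: "partition_on M P" and D: "\<And>A x y. \<lbrakk>A \<in> P; x \<in> A; y \<in> A\<rbrakk> \<Longrightarrow> d x y \<le> D"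
    and c: "c ` P \<subseteq> {..<2::nat}"
      "\<And>A B. \<lbrakk>A \<in> P; B \<in> P; m_graph_adj d m A B\<rbrakk> \<Longrightarrow> c A \<noteq> c B"
    using assms(1,2) unfolding asdim_le_def m_graph_colorable_def
    by (auto simp: numeral_2_eq_2) metis
  define p where "p x = (SOME A. A \<in> P \<and> x \<in> A)" for x
  have p: "p x \<in> P" "x \<in> p x" if "x \<in> M" for x
    using someI_ex[of "\<lambda>A. A \<in> P \<and> x \<in> A"] that P by (auto simp: p_def partition_on_def)
  have differ: "c (p x) \<noteq> c (p y)" if "x \<in> M" "y \<in> M" "d x y \<le> m" "p x \<noteq> p y" for x y
  proof -
    \<comment> \<open>A real infimum is a lower bound only for sets bounded below, hence the use of
      \<open>nonneg\<close>.\<close>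
    have "bdd_below {d u v |u v. u \<in> p x \<and> v \<in> p y}"
      using nonneg by (intro bdd_belowI[of _ 0]) auto
    moreover have "d x y \<in> {d u v |u v. u \<in> p x \<and> v \<in> p y}" using p that by blast
    ultimately have "set_distance d (p x) (p y) \<le> d x y"
      unfolding set_distance_def by (rule cInf_lower[rotated])
    then show ?thesis using c(2) p that by (auto simp: m_graph_adj_def)
  qed
  have two: "c (p x) < 2" if "x \<in> M" for x using c(1) p that by auto
  show thesis
  proof (rule that)
    show "d x y \<le> D" if "x \<in> M" "y \<in> M" "p x = p y" for x y
      using D[of "p x"] p that by metis
    show "p x = p y \<or> p y = p z \<or> p x = p z"
      if "x \<in> M" "y \<in> M" "z \<in> M" "d x y \<le> m" "d y z \<le> m" "d x z \<le> m" for x y z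
      using that differ[of x y] differ[of y z] differ[of x z] two[of x] two[of y] two[of z]
      by linarith
  qed
qed

theorem theorem5p12:
  fixes G :: "('a, 'b) monoid_scheme" and S :: "'a set"
  assumes "group G"
    and "finitely_presentable G"
    and "group_adim_eq G 1"
    and "finite_generating_set G S"
  shows "\<exists>M::nat. M > 0 \<and> (\<forall>vs. m_sequence G S 1 vs \<longrightarrow> m_triangulable G S M vs)"
proof -
  interpret G: group G by fact
  interpret S: cayley_graph G S by unfold_locales fact
  obtain T where T: "finite_generating_set G T"
      "asdim_le (carrier G) (\<lambda>g h. real (cayley_dist G T g h)) 1"
    using assms(3) by (auto simp: group_adim_eq_def asdim_eq_def)
  interpret T: cayley_graph G T by unfold_locales fact
  obtain C where C: "\<And>x y. \<lbrakk>x \<in> carrier G; y \<in> carrier G\<rbrakk> \<Longrightarrow> S.dS x y \<le> C * T.dS x y"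
    using cayley_dist_bound[OF S.cayley_graph_axioms T.cayley_graph_axioms] by blast
  obtain n :: nat and R f where R: "finite R" "R \<subseteq> carrier (free_group {..<n})"
    and f: "f \<in> hom (free_group {..<n}) G" "f ` carrier (free_group {..<n}) = carrier G"
    and ker: "kernel (free_group {..<n}) G f = normal_closure (free_group {..<n}) R"
    using finitely_presentable_cover[OF assms(1,2)] by metis
  \<comment> \<open>\<open>ev\<close> depends neither on the pieces nor on the edge relation; this trivial instance makes it
    available for fixing the scale, on which the actual pieces depend.\<close>
  interpret A: free_cover G "{..<n}" f "\<lambda>_. ()" "\<lambda>_ _. True"
    by unfold_locales (use f in auto)
  define rep where "rep A = (SOME w. w \<in> words {..<n} \<and> A = free_eq {..<n} `` {w})" for A
  have rep: "rep A \<in> words {..<n}" "A = free_eq {..<n} `` {rep A}" if "A \<in> R" for A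
  proof -
    have "\<exists>w. w \<in> words {..<n} \<and> A = free_eq {..<n} `` {w}"
      using R(2) that free_group_class_exhaust by (metis subsetD)
    from someI_ex[OF this] show "rep A \<in> words {..<n}" "A = free_eq {..<n} `` {rep A}"
      by (simp_all add: rep_def)
  qed
  define wd where "wd x = (SOME w. w \<in> words {..<n} \<and> A.ev w = x)" for x
  have wd: "wd x \<in> words {..<n}" "A.ev (wd x) = x" if "x \<in> carrier G" for x
    using someI_ex[of "\<lambda>w. w \<in> words {..<n} \<and> A.ev w = x"] A.ev_surj[OF that]
    by (auto simp: wd_def)
  \<comment> \<open>These are the words whose translates must be short at the chosen scale:
    relators, so that they lift trivially; words for generators and their inverses, for the steps of
    a sequence; and single letters, for \<open>edge\<close>.\<close>
  define W where "W = rep ` R \<union> wd ` S \<union> wd ` (\<lambda>x. inv\<^bsub>G\<^esub> x) ` S \<union>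
    (\<lambda>a. [a]) ` ({..<n} \<times> UNIV)"
  have W: "finite W" "W \<subseteq> words {..<n}"
    using R(1) S.fgs rep wd S.S_carrier A.letter_words
    by (auto simp: W_def finite_generating_set_def)
  have "finite (\<Union>w\<in>W. (\<lambda>(i, j). T.dS (A.ev (take i w)) (A.ev (take j w))) `
      ({..length w} \<times> {..length w}))"
    using W by auto
  then obtain m where m: "\<And>w i j. \<lbrakk>w \<in> W; i \<le> length w; j \<le> length w\<rbrakk>
      \<Longrightarrow> T.dS (A.ev (take i w)) (A.ev (take j w)) \<le> m"
    unfolding finite_nat_set_iff_bounded_le by auto
  \<comment> \<open>The scale is \<open>Suc m\<close> because it has to be positive.\<close>
  obtain p :: "'a \<Rightarrow> 'a set" and D where
      D: "\<And>x y. \<lbrakk>x \<in> carrier G; y \<in> carrier G; p x = p y\<rbrakk> \<Longrightarrow> real (T.dS x y) \<le> D"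
    and two: "\<And>x y z. \<lbrakk>x \<in> carrier G; y \<in> carrier G; z \<in> carrier G;
        real (T.dS x y) \<le> real (Suc m); real (T.dS y z) \<le> real (Suc m);
        real (T.dS x z) \<le> real (Suc m)\<rbrakk> \<Longrightarrow> p x = p y \<or> p y = p z \<or> p x = p z"
    by (rule asdim_le_1_map[OF T(2), of "real (Suc m)"]) auto
  define D' where "D' = nat \<lceil>D\<rceil>"
  have D': "T.dS x y \<le> D'" if "x \<in> carrier G" "y \<in> carrier G" "p x = p y" for x y
    using D[OF that] unfolding D'_def by linarith
  \<comment> \<open>Travel within one piece, across a gap of length at most \<open>m\<close>, and
    within another piece, converted to the \<open>S\<close>-metric by \<open>C\<close>;
    \<open>Suc\<close> makes \<open>M\<close> positive.\<close>
  define M where "M = Suc (C * (D' + m + D'))"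
  have dS: "S.dS x y \<le> M" if "x \<in> carrier G" "y \<in> carrier G" "T.dS x y \<le> D' + m + D'" for x y
    unfolding M_def using C[OF that(1,2)] mult_le_mono2[OF that(3), of C] by linarith
  \<comment> \<open>The relation \<open>E\<close> is defined by the distance bound wanted for
    adjacent pieces; the next step shows that pieces of points at \<open>T\<close>-distance at most
    \<open>m\<close> satisfy it.\<close>
  define E where "E U V \<longleftrightarrow> (\<forall>x\<in>carrier G. \<forall>y\<in>carrier G. p x = U \<longrightarrow> p y = V \<longrightarrow> S.dS x y \<le> M)"
    for U V
  have E: "E (p x) (p y)" if xy: "x \<in> carrier G" "y \<in> carrier G" "T.dS x y \<le> m" for x y
    unfolding E_def
  proof (intro ballI impI dS)
    fix u v assume uv: "u \<in> carrier G" "v \<in> carrier G" "p u = p x" "p v = p y"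
    have "T.dS u v \<le> T.dS u x + T.dS x v" using uv xy by (intro T.dist_triangle)
    also have "T.dS x v \<le> T.dS x y + T.dS y v" using uv xy by (intro T.dist_triangle)
    finally show "T.dS u v \<le> D' + m + D'"
      using D'[of u x] D'[of y v] uv xy by simp
  qed
  have prefix: "T.dS (g \<otimes>\<^bsub>G\<^esub> A.ev (take i w)) (g \<otimes>\<^bsub>G\<^esub> A.ev (take j w)) \<le> m"
    if "g \<in> carrier G" "w \<in> W" "i \<le> length w" "j \<le> length w" for g w i j
    using m[OF that(2-4)] T.dist_left_le[of "A.ev (take i w)" "A.ev (take j w)" g] that W(2)
      A.ev_closed words_take by (meson le_trans subsetD)
  interpret P: free_cover G "{..<n}" f p E
  proof unfold_locales
    fix g x b assume g: "g \<in> carrier G" and x: "x \<in> {..<n}"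
    then have "[(x, b)] \<in> W" by (auto simp: W_def)
    then have "T.dS (g \<otimes>\<^bsub>G\<^esub> A.ev [(x, b)]) g \<le> m"
      using prefix[OF g, of "[(x, b)]" 1 0] g by (simp add: A.ev_Nil)
    then show "E (p (g \<otimes>\<^bsub>G\<^esub> f (free_eq {..<n} `` {[(x, b)]}))) (p g)"
      using g x A.ev_closed[OF A.letter_words[of x b]] by (intro E) (simp_all add: A.ev_def)
  qed (use f in auto)
  \<comment> \<open>The point \<open>g\<close> and any two prefix points are pairwise close, so
    their pieces are not all distinct. Hence at most one piece other than \<open>p g\<close> is
    met.\<close>
  have narrow: "P.narrow w" if w: "w \<in> W" for w
    unfolding P.narrow_def
  proof
    fix g assume g: "g \<in> carrier G"
    let ?q = "\<lambda>k. g \<otimes>\<^bsub>G\<^esub> A.ev (take k w)"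
    have q: "?q k \<in> carrier G" for k using g w W(2) A.ev_closed words_take by blast
    have q0: "?q 0 = g" using g by (simp add: A.ev_Nil)
    have two': "p g = p (?q i) \<or> p (?q i) = p (?q j) \<or> p g = p (?q j)"
      if "i \<le> length w" "j \<le> length w" for i j
      using two[OF q q q, of 0 i j] prefix[OF g w, of 0 i] prefix[OF g w, of i j]
        prefix[OF g w, of 0 j] that q0 by simp
    show "\<exists>V. \<forall>k\<le>length w. p (?q k) \<in> {p g, V}"
    proof (cases "\<exists>k\<le>length w. p (?q k) \<noteq> p g")
      case True
      then obtain k where "k \<le> length w" "p (?q k) \<noteq> p g" by blast
      then show ?thesis using two'[of k] by (intro exI[of _ "p (?q k)"]) auto
    qed auto
  qed
  have trivial: "P.act z w = z" if "w \<in> words {..<n}" "P.ev w = \<one>\<^bsub>G\<^esub>" "z \<in> P.states" for w z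
  proof (rule P.act_relator[OF equalityD1[OF ker] R(2) _ that])
    fix A assume A: "A \<in> R"
    have "R \<subseteq> kernel (free_group {..<n}) G f"
      unfolding ker normal_closure_def by blast
    then have "f A = \<one>\<^bsub>G\<^esub>" using A by (auto simp: kernel_def)
    moreover have "rep A \<in> W" using A by (auto simp: W_def)
    ultimately show "\<exists>w\<in>words {..<n}. A = free_eq {..<n} `` {w} \<and> P.ev w = \<one>\<^bsub>G\<^esub> \<and> P.narrow w"
      using rep[OF A] narrow unfolding P.ev_def by metis
  qed
  have "m_triangulable G S M vs" if vs: "m_sequence G S 1 vs" for vs
  proof -
    \<comment> \<open>The tree map depends on the starting point of the sequence, whereas
      \<open>M\<close> is already fixed.\<close>
    let ?b = "hd vs"
    have seq: "vs \<noteq> []" "set vs \<subseteq> carrier G" "last vs = ?b"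
      using vs by (auto simp: m_sequence_def)
    then have b: "?b \<in> carrier G" by (meson hd_in_set subsetD)
    obtain t where t: "t ?b = [p ?b]" "\<And>x. x \<in> carrier G \<Longrightarrow> reduced_walk E (t x)"
        "\<And>x. x \<in> carrier G \<Longrightarrow> hd (t x) = p x"
        "\<And>x v. \<lbrakk>x \<in> carrier G; v \<in> words {..<n}; P.narrow v\<rbrakk>
          \<Longrightarrow> t (x \<otimes>\<^bsub>G\<^esub> A.ev v) = push (p (x \<otimes>\<^bsub>G\<^esub> A.ev v)) (t x)"
      using P.tree_map_exists[OF trivial b] by blast
    have step: "tree_near (t x) (t (x \<otimes>\<^bsub>G\<^esub> A.ev v))" if "x \<in> carrier G" "v \<in> W" for x v
      using t(4)[of x v] that W(2) narrow tree_near_push by (metis subsetD)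
    \<comment> \<open>The first edge of the reduced walk \<open>t y\<close> joins \<open>p y\<close>
      to \<open>p x\<close>, and \<open>E\<close> turns it into a distance bound.\<close>
    have tl_near: "S.dS y x \<le> M"
      if "x \<in> carrier G" "y \<in> carrier G" "t x = tl (t y)" for x y
      using reduced_walk_tl_edge[OF t(2)[OF that(2)]] t(2)[OF that(1)] t(3) that
        reduced_walk_nonempty by (metis E_def)
    show ?thesis
    proof (rule triangulable_of_tree_map[of G t S M ?b])
      show "S.dS x y \<le> M" if xy: "x \<in> carrier G" "y \<in> carrier G" "tree_near (t x) (t y)" for x y
      proof -
        consider "t x = t y" | "t x = tl (t y)" | "t y = tl (t x)"
          using xy by (auto simp: tree_near_def)
        then show ?thesis
        proof cases
          case 1
          then have "p x = p y" using t(3) xy by metis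
          then show ?thesis using D' xy by (intro dS) (simp_all add: trans_le_add1)
        next
          case 2
          then show ?thesis using tl_near[of x y] S.dist_sym[of x y] xy by simp
        next
          case 3
          then show ?thesis using tl_near[of y x] xy by simp
        qed
      qed
      show "t x \<noteq> []" if "x \<in> carrier G" for x using t(2)[OF that] by (rule reduced_walk_nonempty)
      show "length (t ?b) = 1" using t(1) by simp
      fix i assume i: "i + 1 < length vs"
      let ?x = "vs ! i" and ?y = "vs ! (i + 1)"
      have xy: "?x \<in> carrier G" "?y \<in> carrier G" using seq(2) i by (simp_all add: subset_iff)
      have "S.dS ?x ?y \<le> 1" using vs i by (simp add: m_sequence_def)
      \<comment> \<open>A step of the sequence is stationary or is spelled by a word in
        \<open>W\<close>, whose narrowness makes the lift move by a single
        \<open>push\<close>.\<close>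
      then consider "?x = ?y" | s where "s \<in> S" "?y = ?x \<otimes>\<^bsub>G\<^esub> s \<or> ?y = ?x \<otimes>\<^bsub>G\<^esub> inv\<^bsub>G\<^esub> s"
        using S.dist_le_1[OF xy] by blast
      then show "tree_near (t ?x) (t ?y)"
      proof cases
        case 1
        then show ?thesis by (simp add: tree_near_def)
      next
        case 2
        then have "wd s \<in> W" "wd (inv\<^bsub>G\<^esub> s) \<in> W" by (auto simp: W_def)
        with 2 show ?thesis using step[OF xy(1)] wd S.S_carrier by (metis G.inv_closed)
      qed
    qed (use seq in auto)
  qed
  moreover have "M > 0" by (simp add: M_def)
  ultimately show ?thesis by blast
qed

end
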